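(* Let $Z$ be an elliptic genus with data $h,\mathcal{D},\delta$, $\hat c=\mathcal{D}-2\delta/h$ (in the sense of the context), with twisted Witten indices $\mathfrak{X}_v$, and let $\Upsilon$ be the element of the group ring defined in the context. Then $\Upsilon$ can be uniquely expanded as $\Upsilon=\sum_{d\mid h}u_d\Lambda_d$ with $u_d\in\mathbb{Z}$, and for these same integers $u_d$ one has $$\mathfrak{X}_v=\sum_{d\mid h}u_d\,(\Delta_d)_v\qquad\text{for all } v\in\mathbb{Z}^2 .$$ Equivalently, $\mathfrak{X}_{(r,s)}=\sum_{d\mid \gcd(h,r,s)}u_d\,d$ for all $(r,s)\in\mathbb{Z}^2$.
   Context: Notation: $\mathbf{e}[x]=\exp(2\pi\sqrt{-1}\,x)$; $\zeta_n=\mathbf{e}[1/n]$; $\mathbb{H}$ is the upper half-plane; $q^a=\mathbf{e}[a\tau]$, $y^a=\mathbf{e}[az]$ for $a\in\mathbb{Q}$. Data: a positive integer $h$ and integers $\mathcal{D},\delta$ such that $\hat c=\mathcal{D}-2\delta/h\ge 0$. An elliptic genus with these data is a holomorphic function $Z$ on $\mathbb{H}\times\mathbb{C}$ with the following properties. (a) $Z(\tau,z)=\sum_{n\ge0}\mathfrak{Z}_n(z)q^n$ with $\mathfrak{Z}_n(z)\in y^{-\hat c/2}\,\mathbb{Z}[y^{1/h},y^{-1/h}]$, and $\mathfrak{Z}_0(z)=y^{-\hat c/2}\chi_y$ with $\chi_y\in\mathbb{Z}[y^{1/h}]$. (b) $Z\left(\frac{a\tau+b}{c\tau+d},\frac{z}{c\tau+d}\right)=\mathbf{e}\left[\frac{\hat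 c}{2}\frac{cz^2}{c\tau+d}\right]Z(\tau,z)$ for all $\begin{pmatrix}a&b\\c&d\end{pmatrix}\in \mathrm{SL}_2(\mathbb{Z})$. (c) $Z(\tau,z+r\tau+s)=(-1)^{\hat c(r+s)}\,\mathbf{e}\left[-\frac{\hat c}{2}(r^2\tau+2rz)\right]Z(\tau,z)$ for all $(r,s)\in(h\mathbb{Z})^2$ (note $\hat c h\in\mathbb{Z}$). For $v=(r,s)\in\mathbb{Z}^2$ the twisted elliptic genus is $$Z_{(r,s)}(\tau,z)=(-1)^{\mathcal{D}(r+s+rs)}\,\mathbf{e}\left[\tfrac{\hat c}{2}(r^2\tau+2rz+rs)\right]Z(\tau,z+r\tau+s).$$ (d) Standing assumption: for every $v\in\mathbb{Z}^2$, $\mathfrak{X}_v:=Z_v(\tau,0)$ is independent of $\tau$; it is called the twisted Witten index. Group ring: let $\mathbb{C}\mathbb{G}_m$ be the group ring over $\mathbb{C}$ of the multiplicative group $\mathbb{G}_m=\mathbb{C}^\times$, and write $\langle\xi\rangle$ for the basis element attached to $\xi\in\mathbb{C}^\times$. For a positive integer $d$ put $\Lambda_d=\sum_{i\in\mathbb{Z}/d\mathbb{Z}}\langle\zeta_d^i\rangle$. Writing $y^{\delta/h}\chi_y=\sum_i n_i y^{i/h}$ (finite sum over $i\in\mathbb{Z}$, $n_i\in\mathbb{Z}$), put $\Upsilon=\sum_i n_i\langle\zeta_h^i\rangle$. For a positive integer $d$ and $v=(r,s)\in\mathbb{Z}^2$: $(\Delta_d)_v=d$ if $d\mid r$ and $d\mid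 s$, and $(\Delta_d)_v=0$ otherwise. *)

theory Defs
  imports
    "HOL-Analysis.Analysis"
    "HOL-Library.Poly_Mapping"
    "HOL-Computational_Algebra.Polynomial"
begin

text \<open>
  The group \<open>\<complex>\<^sup>\<times>\<close>, written additively: \<^typ>\<open>'a \<Rightarrow>\<^sub>0 'b\<close> carries the convolution product for an
  additive monoid of exponents, so that \<open>gm \<Rightarrow>\<^sub>0 complex\<close> is the group ring of \<open>\<complex>\<^sup>\<times>\<close> over \<open>\<complex>\<close>,
  whereas \<open>complex \<Rightarrow>\<^sub>0 complex\<close> would be that of the additive group of \<open>\<complex>\<close>.
\<close>

typedef gm = "{\<xi>::complex. \<xi> \<noteq> 0}"
  by (rule exI[of _ 1]) simp

setup_lifting type_definition_gm

instantiation gm :: ab_group_add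
begin

lift_definition zero_gm :: gm is 1 by simp
lift_definition plus_gm :: "gm \<Rightarrow> gm \<Rightarrow> gm" is "(*)" by simp
lift_definition uminus_gm :: "gm \<Rightarrow> gm" is inverse by simp
lift_definition minus_gm :: "gm \<Rightarrow> gm \<Rightarrow> gm" is "(/)" by simp

instance by standard (transfer; simp add: field_simps)+

end

type_synonym gring = "gm \<Rightarrow>\<^sub>0 complex"

text \<open>Only meaningful for \<open>\<xi> \<noteq> 0\<close>.\<close>

definition bas :: "complex \<Rightarrow> gring" where
  "bas \<xi> = Poly_Mapping.single (Abs_gm \<xi>) 1"

lemma bas_1: "bas 1 = 1"
  unfolding bas_def zero_gm.abs_eq[symmetric] by simp

lemma bas_mult: "\<xi> \<noteq> 0 \<Longrightarrow> \<eta> \<noteq> 0 \<Longrightarrow> bas \<xi> * bas \<eta> = bas (\<xi> * \<eta>)"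
  by (simp add: bas_def mult_single plus_gm.abs_eq eq_onp_def)

definition ee :: "complex \<Rightarrow> complex" where
  "ee x = exp (2 * of_real pi * \<i> * x)"

definition zeta :: "nat \<Rightarrow> complex" where
  "zeta n = ee (1 / of_nat n)"

definition Lam :: "nat \<Rightarrow> gring" where
  "Lam d = (\<Sum>i<d. bas (zeta d ^ i))"

definition upper_half_plane :: "complex set" where
  "upper_half_plane = {\<tau>. Im \<tau> > 0}"

text \<open>Holomorphy in two variables: a \<open>\<complex>\<close>-linear total derivative exists at every point.\<close>

definition holomorphic2_on :: "(complex \<Rightarrow> complex \<Rightarrow> complex) \<Rightarrow> (complex \<times> complex) set \<Rightarrow> bool" where
  "holomorphic2_on f S \<longleftrightarrow>
     (\<forall>p\<in>S. \<exists>a b. ((\<lambda>(x, y). f x y) has_derivative (\<lambda>(x, y). a * x + b * y)) (at p))"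

text \<open>
  \<open>laurent_y h p z\<close> and \<open>poly_y h p z\<close> are the values at \<open>z\<close> of integral Laurent polynomials
  and polynomials \<open>p\<close> in \<open>y\<^bsup>1/h\<^esup>\<close>, where \<open>y\<^bsup>a\<^esup> = ee (a * z)\<close>.
\<close>

definition laurent_y :: "nat \<Rightarrow> (int \<Rightarrow>\<^sub>0 int) \<Rightarrow> complex \<Rightarrow> complex" where
  "laurent_y h p z =
     (\<Sum>i\<in>Poly_Mapping.keys p. of_int (Poly_Mapping.lookup p i) * ee (of_int i / of_nat h * z))"

definition poly_y :: "nat \<Rightarrow> int poly \<Rightarrow> complex \<Rightarrow> complex" where
  "poly_y h p z = poly (map_poly of_int p) (ee (z / of_nat h))"

definition chat :: "nat \<Rightarrow> int \<Rightarrow> int \<Rightarrow> real" where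
  "chat h D \<delta> = of_int D - 2 * of_int \<delta> / of_nat h"

text \<open>
  The coefficient functions \<open>ZZ\<close> of the expansion in \<open>q\<close> and the polynomial \<open>chi\<close> (that is,
  \<open>\<chi>\<^sub>y\<close> as a polynomial in \<open>y\<^bsup>1/h\<^esup>\<close>) are determined by \<open>Z\<close>; they are parameters only to be
  available by name. In the last axiom \<open>chat h D \<delta> * (r + s)\<close> is an integer because \<open>h\<close>
  divides \<open>r\<close> and \<open>s\<close>, so the floor only converts the type.
\<close>

locale elliptic_genus =
  fixes h :: nat and D \<delta> :: int
    and Z :: "complex \<Rightarrow> complex \<Rightarrow> complex"
    and ZZ :: "nat \<Rightarrow> complex \<Rightarrow> complex"
    and chi :: "int poly"
  assumes h_pos: "h > 0"
    and chat_nonneg: "chat h D \<delta> \<ge> 0"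
    and holomorphic: "holomorphic2_on Z (upper_half_plane \<times> UNIV)"
    and q_expansion: "\<And>\<tau> z. \<tau> \<in> upper_half_plane \<Longrightarrow> (\<lambda>n. ZZ n z * ee (of_nat n * \<tau>)) sums Z \<tau> z"
    and ZZ_laurent: "\<And>n. \<exists>p. \<forall>z. ZZ n z = ee (- of_real (chat h D \<delta>) / 2 * z) * laurent_y h p z"
    and ZZ_0: "\<And>z. ZZ 0 z = ee (- of_real (chat h D \<delta>) / 2 * z) * poly_y h chi z"
    and modular: "\<And>(a::int) (b::int) (c::int) (d::int) \<tau> z.
        a * d - b * c = 1 \<Longrightarrow> \<tau> \<in> upper_half_plane \<Longrightarrow>
        Z ((of_int a * \<tau> + of_int b) / (of_int c * \<tau> + of_int d)) (z / (of_int c * \<tau> + of_int d)) =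
        ee (of_real (chat h D \<delta>) / 2 * (of_int c * z\<^sup>2 / (of_int c * \<tau> + of_int d))) * Z \<tau> z"
    and elliptic: "\<And>(r::int) (s::int) \<tau> z.
        int h dvd r \<Longrightarrow> int h dvd s \<Longrightarrow> \<tau> \<in> upper_half_plane \<Longrightarrow>
        Z \<tau> (z + of_int r * \<tau> + of_int s) =
        (-1) powi \<lfloor>chat h D \<delta> * of_int (r + s)\<rfloor> *
        ee (- of_real (chat h D \<delta>) / 2 * ((of_int r)\<^sup>2 * \<tau> + 2 * of_int r * z)) * Z \<tau> z"

definition twisted ::
    "nat \<Rightarrow> int \<Rightarrow> int \<Rightarrow> (complex \<Rightarrow> complex \<Rightarrow> complex) \<Rightarrow> int \<Rightarrow> int \<Rightarrow> complex \<Rightarrow> complex \<Rightarrow> complex" where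
  "twisted h D \<delta> Z r s \<tau> z =
     (-1) powi (D * (r + s + r * s)) *
     ee (of_real (chat h D \<delta>) / 2 * ((of_int r)\<^sup>2 * \<tau> + 2 * of_int r * z + of_int r * of_int s)) *
     Z \<tau> (z + of_int r * \<tau> + of_int s)"

text \<open>Only meaningful when \<open>twisted h D \<delta> Z r s \<tau> 0\<close> does not depend on \<open>\<tau>\<close>.\<close>

definition twisted_Witten_index ::
    "nat \<Rightarrow> int \<Rightarrow> int \<Rightarrow> (complex \<Rightarrow> complex \<Rightarrow> complex) \<Rightarrow> int \<Rightarrow> int \<Rightarrow> complex" where
  "twisted_Witten_index h D \<delta> Z r s =
     (THE w. \<forall>\<tau>\<in>upper_half_plane. twisted h D \<delta> Z r s \<tau> 0 = w)"

text \<open>The coefficient of \<open>y\<^bsup>i/h\<^esup>\<close> in \<open>y\<^bsup>\<delta>/h\<^esup> \<chi>\<^sub>y\<close>.\<close>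

definition chi_shift_coeff :: "int \<Rightarrow> int poly \<Rightarrow> int \<Rightarrow> int" where
  "chi_shift_coeff \<delta> chi i = (if i \<ge> \<delta> then coeff chi (nat (i - \<delta>)) else 0)"

definition Upsilon :: "nat \<Rightarrow> int \<Rightarrow> int poly \<Rightarrow> gring" where
  "Upsilon h \<delta> chi =
     (\<Sum>i | chi_shift_coeff \<delta> chi i \<noteq> 0. of_int (chi_shift_coeff \<delta> chi i) * bas (zeta h powi i))"

definition Delt :: "nat \<Rightarrow> int \<Rightarrow> int \<Rightarrow> int" where
  "Delt d r s = (if int d dvd r \<and> int d dvd s then int d else 0)"

end

theory Submission
  imports Defs
begin

text \<open>
  Acting by \<open>SL\<^sub>2(\<int>)\<close> and shifting \<open>v\<close> by \<open>h\<int>\<^sup>2\<close> leave the twisted Witten index unchanged, so that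
  \<open>X\<^bsub>(r,s)\<^esub> = X\<^bsub>(0,g)\<^esub>\<close> with \<open>g = gcd(h,r,s)\<close>; letting \<open>q \<rightarrow> 0\<close> gives \<open>X\<^bsub>(0,s)\<^esub> = \<Sum>\<^sub>j N\<^sub>j \<zeta>\<^sub>h\<^bsup>js\<^esup>\<close>, where
  \<open>N\<^sub>j\<close> is the coefficient of \<open>\<zeta>\<^sub>h\<^bsup>j\<^esup>\<close> in \<open>\<Upsilon>\<close>. Inverting this discrete Fourier transform shows that \<open>N\<^sub>j\<close>
  depends only on \<open>gcd(j,h)\<close>, and Moebius inversion over the divisors of \<open>h\<close> then produces the integers
  \<open>u\<^sub>d\<close>. Conversely \<open>\<Sum>\<^sub>i \<zeta>\<^sub>d\<^bsup>is\<^esup>\<close> is \<open>d\<close> or \<open>0\<close> according to whether \<open>d\<close> divides \<open>s\<close>, which turns an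
  expansion of \<open>\<Upsilon>\<close> into the formula for the index; that formula is triangular in \<open>u\<close>, hence uniqueness.
\<close>

section \<open>Exponentials and sums over roots of unity\<close>

lemma ee_add: "ee (x + y) = ee x * ee y"
  by (simp add: ee_def algebra_simps exp_add)

lemma ee_nonzero [simp]: "ee x \<noteq> 0"
  by (simp add: ee_def)

lemma ee_powi: "ee x powi k = ee (of_int k * x)"
  by (simp add: ee_def exp_power_int mult_ac)

lemma ee_power: "ee x ^ n = ee (of_nat n * x)"
  using ee_powi[of x "int n"] by simp

lemma ee_eq_1_iff: "ee x = 1 \<longleftrightarrow> x \<in> \<int>"
proof
  assume "ee x = 1"
  then obtain n :: int where "Re x = of_int n" "Im x = 0"
    by (auto simp: ee_def exp_eq_1)
  then have "x = of_int n"
    by (simp add: complex_eq_iff)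
  then show "x \<in> \<int>" by simp
next
  assume "x \<in> \<int>"
  then obtain n :: int where "x = of_int n" by (auto elim: Ints_cases)
  then show "ee x = 1"
    by (auto simp: ee_def exp_eq_1)
qed

lemma ee_eqI: "x - y \<in> \<int> \<Longrightarrow> ee x = ee y"
  using ee_add[of y "x - y"] ee_eq_1_iff[of "x - y"] by simp

lemma ee_eq_iff: "ee x = ee y \<longleftrightarrow> x - y \<in> \<int>"
proof -
  have "ee x = ee (x - y) * ee y"
    by (simp flip: ee_add)
  then show ?thesis
    by (simp flip: ee_eq_1_iff)
qed

lemma ee_half: "ee (of_int k / 2) = (-1) powi k"
proof -
  have "ee (1 / 2) = -1"
    by (simp add: ee_def)
  then show ?thesis
    using ee_powi[of "1/2" k] by simp
qed

lemma of_int_div_of_nat_in_Ints_iff: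
  assumes "h > 0"
  shows "(of_int k / of_nat h :: complex) \<in> \<int> \<longleftrightarrow> int h dvd k"
  using of_int_div_of_int_in_Ints_iff[of k "int h", where ?'a = complex] assms by simp

lemma sum_multiples:
  fixes g :: "nat \<Rightarrow> 'a::comm_monoid_add"
  assumes "d dvd h" "h > 0"
  shows "(\<Sum>j<h. if d dvd j then g j else 0) = (\<Sum>i<h div d. g (d * i))"
proof -
  from assms obtain e where h: "h = d * e" and d: "d > 0" by (auto elim: dvdE)
  have "(\<Sum>j<h. if d dvd j then g j else 0) = sum g {j. j < h \<and> d dvd j}"
    by (auto simp: sum.If_cases intro!: sum.cong)
  also have "{j. j < h \<and> d dvd j} = (*) d ` {..<e}"
    using d by (auto simp: h)
  also have "sum g \<dots> = (\<Sum>i<e. g (d * i))"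
    using d by (subst sum.reindex) (auto simp: inj_on_def)
  finally show ?thesis using d by (simp add: h)
qed

text \<open>A geometric series whose ratio is an \<open>h\<close>-th root of unity, equal to 1
  exactly when \<open>h\<close> divides \<open>k\<close>.\<close>

lemma sum_roots_of_unity:
  assumes "h > 0"
  shows "(\<Sum>i<h. ee (of_int k * of_nat i / of_nat h)) = (if int h dvd k then of_nat h else 0)"
proof -
  define x where "x = ee (of_int k / of_nat h)"
  have *: "(\<Sum>i<h. ee (of_int k * of_nat i / of_nat h)) = (\<Sum>i<h. x ^ i)"
    by (simp add: x_def ee_power mult_ac)
  show ?thesis
  proof (cases "int h dvd k")
    case True
    then have "x = 1"
      using assms by (simp add: x_def ee_eq_1_iff of_int_div_of_nat_in_Ints_iff)
    with True show ?thesis by (simp add: *)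
  next
    case False
    then have "x \<noteq> 1"
      using assms by (simp add: x_def ee_eq_1_iff of_int_div_of_nat_in_Ints_iff)
    moreover have "x ^ h = 1"
      using assms by (simp add: x_def ee_power ee_eq_1_iff)
    ultimately show ?thesis
      using False by (simp add: * geometric_sum)
  qed
qed

text \<open>Only the indices \<open>d * i\<close> survive, which leaves the sum of the
  \<open>k\<close>-th powers of all roots of unity of order dividing \<open>h div d\<close>.\<close>

lemma sum_roots_of_unity_multiples:
  assumes "d dvd h" "h > 0"
  shows "(\<Sum>j<h. if d dvd j then ee (of_int k * of_nat j / of_nat h) else 0) =
         (if int (h div d) dvd k then of_nat (h div d) else 0)"
proof -
  from assms obtain e where h: "h = d * e" and d: "d > 0" and e: "e > 0" by (auto elim: dvdE)
  have "(\<Sum>j<h. if d dvd j then ee (of_int k * of_nat j / of_nat h) else 0) =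
        (\<Sum>i<e. ee (of_int k * of_nat i / of_nat e))"
    using assms d by (subst sum_multiples) (simp_all add: h field_simps)
  then show ?thesis
    using sum_roots_of_unity[OF e, of k] d by (simp add: h)
qed

section \<open>Moebius inversion over divisors and Fourier coefficients\<close>

function divisor_inversion :: "(nat \<Rightarrow> 'a::ab_group_add) \<Rightarrow> nat \<Rightarrow> 'a" where
  "divisor_inversion F n = F n - (\<Sum>e | e dvd n \<and> e < n. divisor_inversion F e)"
  by auto
termination by (relation "Wellfounded.measure snd") auto

declare divisor_inversion.simps [simp del]

lemma sum_divisors_split:
  fixes w :: "nat \<Rightarrow> 'a::comm_monoid_add"
  assumes "n > 0"
  shows "(\<Sum>e | e dvd n. w e) = w n + (\<Sum>e | e dvd n \<and> e < n. w e)"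
proof -
  have "{e. e dvd n} = insert n {e. e dvd n \<and> e < n}"
    using assms by (auto dest: dvd_imp_le)
  then show ?thesis
    by simp
qed

text \<open>True by construction, since the recursion subtracts the values at proper divisors. No
  division occurs, so an integral \<open>F\<close> has an integral inversion; this is where the
  integrality of \<open>u\<close> comes from.\<close>

lemma sum_divisor_inversion:
  assumes "n > 0"
  shows "(\<Sum>e | e dvd n. divisor_inversion F e) = F n"
  using assms by (simp add: sum_divisors_split divisor_inversion.simps[of F n])

text \<open>The system is triangular: the sum at \<open>n\<close> is \<open>a n\<close> plus values
  at proper divisors, which agree by induction.\<close>

lemma divisor_sums_eq_imp_eq:
  fixes a b :: "nat \<Rightarrow> 'a::cancel_comm_monoid_add"
  assumes "\<And>n. n dvd h \<Longrightarrow> (\<Sum>d | d dvd n. a d) = (\<Sum>d | d dvd n. b d)"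
    and "n dvd h" "h > 0"
  shows "a n = b n"
  using assms(2)
proof (induction n rule: less_induct)
  case (less n)
  then have "n > 0" using \<open>h > 0\<close> by (auto intro: Nat.gr0I)
  have "(\<Sum>e | e dvd n \<and> e < n. a e) = (\<Sum>e | e dvd n \<and> e < n. b e)"
    using less by (intro sum.cong) (auto intro: dvd_trans)
  then show ?case
    using assms(1)[OF less.prems] by (simp add: sum_divisors_split[OF \<open>n > 0\<close>])
qed

lemma sum_if_divides_eq_sum_dvd_gcd:
  fixes g :: "nat \<Rightarrow> 'a::comm_monoid_add"
  assumes "h > 0"
  shows "(\<Sum>d | d dvd h. if d dvd n then g d else 0) = (\<Sum>d | d dvd gcd n h. g d)"
  using assms by (auto simp: sum.If_cases intro!: sum.cong)

text \<open>The map from \<open>d\<close> to \<open>h div d\<close> is an involution of the set of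
  divisors.\<close>

lemma sum_complementary_divisor:
  fixes g :: "nat \<Rightarrow> 'a::comm_monoid_add"
  assumes "h > 0"
  shows "(\<Sum>d | d dvd h. g (h div d)) = (\<Sum>d | d dvd h. g d)"
  using assms
  by (intro sum.reindex_bij_witness[where i = "\<lambda>d. h div d" and j = "\<lambda>d. h div d"])
     (auto elim!: dvdE)

text \<open>A function of \<open>gcd s h\<close> is a combination of the indicators of
  \<open>d dvd s\<close>, and the transform of each is a multiple of the indicator of
  \<open>h div d dvd j\<close>. Inverting the transform thus shows that \<open>j\<close> enters only
  through the divisors it shares with \<open>h\<close>.\<close>

lemma fourier_coeff_depends_on_gcd:
  fixes N :: "nat \<Rightarrow> int"
  assumes h: "h > 0"
    and f: "\<And>s. f s = (\<Sum>j<h. of_int (N j) * ee (of_nat j * of_nat s / of_nat h))"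
    and f_gcd: "\<And>s. f s = f (gcd s h)"
    and periodic: "\<And>j. N (j mod h) = N j"
  shows "N j = N (gcd j h)"
proof -
  \<comment> \<open>The coefficients of \<open>f\<close> with respect to the indicators of
    \<open>d dvd s\<close>.\<close>
  define v where "v = divisor_inversion f"
  have f_v: "f s = (\<Sum>d | d dvd h. if d dvd s then v d else 0)" for s
  proof -
    have "f s = (\<Sum>d | d dvd gcd s h. v d)"
      unfolding v_def using h by (subst f_gcd, subst sum_divisor_inversion) simp_all
    then show ?thesis
      using h by (simp only: sum_if_divides_eq_sum_dvd_gcd)
  qed
  \<comment> \<open>Fourier inversion: orthogonality of the characters isolates
    \<open>N j\<close>.\<close>
  have inv1: "(\<Sum>s<h. f s * ee (of_int (- int j) * of_nat s / of_nat h)) = of_nat h * of_int (N j)"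
    if "j < h" for j
  proof -
    have "(\<Sum>s<h. f s * ee (of_int (- int j) * of_nat s / of_nat h)) =
      (\<Sum>s<h. \<Sum>k<h. of_int (N k) * ee (of_int (int k - int j) * of_nat s / of_nat h))"
      unfolding f sum_distrib_right
      by (intro sum.cong refl) (simp add: mult.assoc diff_divide_distrib left_diff_distrib flip: ee_add)
    also have "\<dots> = (\<Sum>k<h. of_int (N k) * (\<Sum>s<h. ee (of_int (int k - int j) * of_nat s / of_nat h)))"
      by (subst sum.swap) (simp add: sum_distrib_left)
    also have "\<dots> = (\<Sum>k<h. if k = j then of_int (N k) * of_nat h else 0)"
    proof (rule sum.cong)
      fix k assume "k \<in> {..<h}"
      then have "int h dvd int k - int j \<longleftrightarrow> k = j"
        using that by (auto simp flip: mod_eq_dvd_iff)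
      then show "of_int (N k) * (\<Sum>s<h. ee (of_int (int k - int j) * of_nat s / of_nat h)) =
        (if k = j then of_int (N k) * of_nat h else 0)"
        by (simp only: sum_roots_of_unity[OF h]) simp
    qed simp
    finally show ?thesis using that by simp
  qed
  have inv: "of_nat h * of_int (N j) =
    (\<Sum>d | d dvd h. v d * (if h div d dvd j then of_nat (h div d) else 0))" if "j < h" for j
  proof -
    have "of_nat h * of_int (N j) =
      (\<Sum>s<h. \<Sum>d | d dvd h. v d * (if d dvd s then ee (of_int (- int j) * of_nat s / of_nat h) else 0))"
      unfolding inv1[OF that, symmetric] f_v sum_distrib_right
      by (intro sum.cong refl) simp
    also have "\<dots> = (\<Sum>d | d dvd h. v d *
        (\<Sum>s<h. if d dvd s then ee (of_int (- int j) * of_nat s / of_nat h) else 0))"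
      by (subst sum.swap) (simp only: sum_distrib_left)
    also have "\<dots> = (\<Sum>d | d dvd h. v d * (if h div d dvd j then of_nat (h div d) else 0))"
    proof (rule sum.cong)
      fix d assume "d \<in> {d. d dvd h}"
      then have d: "d dvd h" by simp
      show "v d * (\<Sum>s<h. if d dvd s then ee (of_int (- int j) * of_nat s / of_nat h) else 0) =
        v d * (if h div d dvd j then of_nat (h div d) else 0)"
        unfolding sum_roots_of_unity_multiples[OF d h] by simp
    qed simp
    finally show ?thesis .
  qed
  have "of_nat h * (of_int (N j) :: complex) = of_nat h * of_int (N (gcd j h))"
  proof -
    \<comment> \<open>The inversion formula is available for indices below \<open>h\<close> only,
      while \<open>gcd j h\<close> equals \<open>h\<close> when \<open>h\<close> divides
      \<open>j\<close>; reducing both indices modulo \<open>h\<close> covers this case.\<close>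
    have "h div d dvd j mod h \<longleftrightarrow> h div d dvd gcd j h mod h" if "d dvd h" for d
    proof -
      from that have "h div d dvd h" by (auto elim!: dvdE)
      then show ?thesis by (simp add: dvd_mod_iff)
    qed
    then have "of_nat h * (of_int (N (j mod h)) :: complex) = of_nat h * of_int (N (gcd j h mod h))"
      using h by (simp add: inv)
    then show ?thesis by (simp only: periodic)
  qed
  then show ?thesis using h by simp
qed

section \<open>Roots of unity in the group ring\<close>

lemma Abs_gm_ee_eq_iff: "Abs_gm (ee x) = Abs_gm (ee y) \<longleftrightarrow> x - y \<in> \<int>"
  by (simp add: Abs_gm_inject ee_eq_iff)

lemma of_nat_diff_div_in_Ints_iff:
  assumes "j < h" "k < h"
  shows "(of_nat k / of_nat h - of_nat j / of_nat h :: complex) \<in> \<int> \<longleftrightarrow> k = j"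
proof -
  have "(of_nat k / of_nat h - of_nat j / of_nat h :: complex) = of_int (int k - int j) / of_nat h"
    by (simp add: diff_divide_distrib)
  also have "\<dots> \<in> \<int> \<longleftrightarrow> int h dvd int k - int j"
    using assms by (intro of_int_div_of_nat_in_Ints_iff) simp
  also have "\<dots> \<longleftrightarrow> k = j"
    using assms by (auto simp flip: mod_eq_dvd_iff)
  finally show ?thesis .
qed

text \<open>Distinct \<open>k < h\<close> give distinct basis elements, so each coefficient can be
  read off; this justifies comparing coefficients below.\<close>

lemma lookup_sum_bas_roots_of_unity:
  assumes "j < h"
  shows "Poly_Mapping.lookup (\<Sum>k<h. of_int (N k) * bas (ee (of_nat k / of_nat h))) (Abs_gm (ee (of_nat j / of_nat h))) =
         of_int (N j)"
proof -
  have "Poly_Mapping.lookup (of_int (N k) * bas (ee (of_nat k / of_nat h))) (Abs_gm (ee (of_nat j / of_nat h))) =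
        (if k = j then of_int (N k) else 0)" if "k < h" for k
  proof -
    have "of_int (N k) * bas (ee (of_nat k / of_nat h)) =
      Poly_Mapping.single (Abs_gm (ee (of_nat k / of_nat h))) (of_int (N k))"
      by (simp add: bas_def mult_single flip: single_of_int)
    then show ?thesis
      using that assms
      by (simp add: lookup_single Abs_gm_ee_eq_iff of_nat_diff_div_in_Ints_iff when_def)
  qed
  then show ?thesis
    using assms by (simp add: lookup_sum)
qed

lemma sum_bas_roots_of_unity_eq_iff:
  "(\<Sum>k<h. of_int (N k) * bas (ee (of_nat k / of_nat h))) =
   (\<Sum>k<h. of_int (M k) * bas (ee (of_nat k / of_nat h))) \<longleftrightarrow> (\<forall>k<h. N k = M k)"
proof
  assume eq: "(\<Sum>k<h. of_int (N k) * bas (ee (of_nat k / of_nat h))) =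
    (\<Sum>k<h. of_int (M k) * bas (ee (of_nat k / of_nat h)))"
  have "of_int (N k) = (of_int (M k) :: complex)" if "k < h" for k
    using lookup_sum_bas_roots_of_unity[OF that, of N] lookup_sum_bas_roots_of_unity[OF that, of M]
    unfolding eq by simp
  then show "\<forall>k<h. N k = M k" by simp
qed simp

text \<open>The \<open>d\<close>-th roots of unity are the \<open>h\<close>-th roots
  \<open>ee (j / h)\<close> with \<open>j\<close> a multiple of \<open>h div d\<close>.\<close>

lemma Lam_eq_sum_bas:
  assumes "d dvd h" "h > 0"
  shows "Lam d = (\<Sum>j<h. of_int (if h div d dvd j then 1 else 0) * bas (ee (of_nat j / of_nat h)))"
proof -
  from assms obtain e where h: "h = d * e" and d: "d > 0" and e: "e > 0" by (auto elim: dvdE)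
  have "(\<Sum>j<h. of_int (if h div d dvd j then 1 else 0) * bas (ee (of_nat j / of_nat h))) =
    (\<Sum>j<h. if e dvd j then bas (ee (of_nat j / of_nat h)) else 0)"
    using d by (intro sum.cong) (auto simp: h)
  also have "\<dots> = (\<Sum>i<d. bas (ee (of_nat (e * i) / of_nat h)))"
    using assms e by (subst sum_multiples) (simp_all add: h)
  also have "\<dots> = Lam d"
    using d e by (simp add: Lam_def zeta_def ee_power h field_simps)
  finally show ?thesis ..
qed

lemma sum_Lam_eq_sum_bas:
  assumes "h > 0"
  shows "(\<Sum>d | d dvd h. of_int (u d) * Lam d) =
    (\<Sum>j<h. of_int (\<Sum>d | d dvd h. if h div d dvd j then u d else 0) * bas (ee (of_nat j / of_nat h)))"
proof -
  have "(\<Sum>d | d dvd h. of_int (u d) * Lam d) = (\<Sum>d | d dvd h. \<Sum>j<h.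
      of_int (if h div d dvd j then u d else 0) * bas (ee (of_nat j / of_nat h)))"
  proof (rule sum.cong)
    fix d assume "d \<in> {d. d dvd h}"
    then show "of_int (u d) * Lam d =
      (\<Sum>j<h. of_int (if h div d dvd j then u d else 0) * bas (ee (of_nat j / of_nat h)))"
      using assms by (subst Lam_eq_sum_bas) (auto simp: sum_distrib_left intro!: sum.cong)
  qed simp
  then show ?thesis
    by (subst (asm) sum.swap) (simp add: sum_distrib_right)
qed

section \<open>Grouping the coefficients of \<open>chi\<close> by exponents modulo
  \<open>h\<close>\<close>

definition residue_coeff :: "nat \<Rightarrow> int \<Rightarrow> int poly \<Rightarrow> nat \<Rightarrow> int" where
  "residue_coeff h \<delta> chi j =
     (\<Sum>i | chi_shift_coeff \<delta> chi i \<noteq> 0 \<and> i mod int h = int j mod int h. chi_shift_coeff \<delta> chi i)"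

lemma finite_chi_shift_support: "finite {i. chi_shift_coeff \<delta> chi i \<noteq> 0}"
proof (rule finite_subset)
  show "{i. chi_shift_coeff \<delta> chi i \<noteq> 0} \<subseteq> {\<delta>..\<delta> + int (degree chi)}"
    using le_degree[of chi] by (force simp: chi_shift_coeff_def split: if_splits)
qed simp

lemma residue_coeff_mod: "residue_coeff h \<delta> chi (j mod h) = residue_coeff h \<delta> chi j"
  by (simp add: residue_coeff_def zmod_int)

text \<open>Stated over any ring because it serves twice: with \<open>P\<close> valued in the group
  ring for \<open>Upsilon\<close>, and with \<open>P\<close> valued in the complex numbers for the
  index.\<close>

lemma sum_chi_shift_by_residue:
  fixes P :: "int \<Rightarrow> 'a::ring_1"
  assumes "h > 0" and P: "\<And>i. P (i mod int h) = P i"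
  shows "(\<Sum>i | chi_shift_coeff \<delta> chi i \<noteq> 0. of_int (chi_shift_coeff \<delta> chi i) * P i) =
         (\<Sum>j<h. of_int (residue_coeff h \<delta> chi j) * P (int j))"
proof -
  let ?I = "{i. chi_shift_coeff \<delta> chi i \<noteq> 0}"
  have "(\<Sum>i\<in>?I. of_int (chi_shift_coeff \<delta> chi i) * P i) =
    (\<Sum>j<h. \<Sum>i | i \<in> ?I \<and> nat (i mod int h) = j. of_int (chi_shift_coeff \<delta> chi i) * P i)"
    using assms(1) finite_chi_shift_support
    by (intro sum.group[symmetric]) (auto simp: nat_less_iff)
  also have "\<dots> = (\<Sum>j<h. of_int (residue_coeff h \<delta> chi j) * P (int j))"
  proof (rule sum.cong)
    fix j assume "j \<in> {..<h}"
    then have *: "nat (i mod int h) = j \<longleftrightarrow> i mod int h = int j mod int h" for i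
      using assms(1) by (auto simp: nat_eq_iff)
    have P_eq: "P i = P (int j)" if "i mod int h = int j mod int h" for i
      using P that by metis
    show "(\<Sum>i | i \<in> ?I \<and> nat (i mod int h) = j. of_int (chi_shift_coeff \<delta> chi i) * P i) =
      of_int (residue_coeff h \<delta> chi j) * P (int j)"
      unfolding * residue_coeff_def of_int_sum sum_distrib_right by (intro sum.cong) (auto intro!: arg_cong2[where f = "(*)"] P_eq)
  qed simp
  finally show ?thesis .
qed

lemma ee_mod_div:
  assumes "h > 0"
  shows "ee (of_int (i mod int h) * of_int s / of_nat h) = ee (of_int i * of_int s / of_nat h)"
proof (rule ee_eqI)
  have "of_int (i mod int h) * of_int s / of_nat h - of_int i * of_int s / of_nat h =
    (of_int (- (i div int h) * s) :: complex)"
    using assms by (simp add: field_simps minus_mult_div_eq_mod[symmetric])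
  then show "of_int (i mod int h) * of_int s / of_nat h - of_int i * of_int s / of_nat h \<in> (\<int> :: complex set)"
    by (metis Ints_of_int)
qed

lemma Upsilon_eq_sum_bas:
  assumes "h > 0"
  shows "Upsilon h \<delta> chi = (\<Sum>j<h. of_int (residue_coeff h \<delta> chi j) * bas (ee (of_nat j / of_nat h)))"
proof -
  have "Upsilon h \<delta> chi = (\<Sum>i | chi_shift_coeff \<delta> chi i \<noteq> 0.
      of_int (chi_shift_coeff \<delta> chi i) * bas (ee (of_int i * of_int 1 / of_nat h)))"
    by (simp add: Upsilon_def zeta_def ee_powi)
  also have "\<dots> = (\<Sum>j<h. of_int (residue_coeff h \<delta> chi j) * bas (ee (of_int (int j) * of_int 1 / of_nat h)))"
    by (intro sum_chi_shift_by_residue assms arg_cong[where f = bas] ee_mod_div)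
  finally show ?thesis by simp
qed

text \<open>Reindexing by \<open>i = k + \<delta>\<close>, where negative exponents may
  occur.\<close>

lemma poly_eq_sum_chi_shift:
  assumes "x \<noteq> (0::complex)"
  shows "x powi \<delta> * poly (map_poly of_int chi) x =
         (\<Sum>i | chi_shift_coeff \<delta> chi i \<noteq> 0. of_int (chi_shift_coeff \<delta> chi i) * x powi i)"
proof -
  have "(\<Sum>i | chi_shift_coeff \<delta> chi i \<noteq> 0. of_int (chi_shift_coeff \<delta> chi i) * x powi i) =
    (\<Sum>k | coeff chi k \<noteq> 0. of_int (coeff chi k) * x powi (int k + \<delta>))"
    by (intro sum.reindex_bij_witness[where i = "\<lambda>k. int k + \<delta>" and j = "\<lambda>i. nat (i - \<delta>)"])
       (auto simp: chi_shift_coeff_def split: if_splits)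
  also have "\<dots> = (\<Sum>k\<le>degree chi. of_int (coeff chi k) * x powi (int k + \<delta>))"
    by (intro sum.mono_neutral_left) (auto simp: le_degree)
  also have "\<dots> = x powi \<delta> * poly (map_poly of_int chi) x"
    using assms
    by (simp add: poly_altdef degree_map_poly coeff_map_poly power_int_add sum_distrib_left mult_ac)
  finally show ?thesis ..
qed

section \<open>The modular action and the limit at the cusp\<close>

lemma moebius_upper_half_plane:
  fixes a b c d :: int
  assumes det: "a * d - b * c = 1" and \<tau>: "\<tau> \<in> upper_half_plane"
  shows "of_int c * \<tau> + of_int d \<noteq> 0"
    and "(of_int a * \<tau> + of_int b) / (of_int c * \<tau> + of_int d) \<in> upper_half_plane"
proof -
  from \<tau> have Im: "Im \<tau> > 0" by (simp add: upper_half_plane_def)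
  show nz: "of_int c * \<tau> + of_int d \<noteq> 0"
  proof
    assume 0: "of_int c * \<tau> + of_int d = 0"
    then have "of_int c * Im \<tau> = 0" by (simp add: complex_eq_iff)
    with Im have "c = 0" by simp
    with 0 have "d = 0" by simp
    with \<open>c = 0\<close> det show False by simp
  qed
  let ?w = "of_int c * \<tau> + of_int d"
  have "Im ((of_int a * \<tau> + of_int b) / ?w) = of_int (a * d - b * c) * Im \<tau> / ((Re ?w)\<^sup>2 + (Im ?w)\<^sup>2)"
    by (simp add: Im_divide algebra_simps)
  moreover have "(Re ?w)\<^sup>2 + (Im ?w)\<^sup>2 > 0"
    using nz by (simp add: complex_neq_0)
  ultimately show "(of_int a * \<tau> + of_int b) / ?w \<in> upper_half_plane"
    using Im det by (simp add: upper_half_plane_def)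
qed

text \<open>With \<open>x = ee \<tau>\<close> the hypothesis describes a power series equal to
  \<open>w\<close> on the punctured unit disc, and its limit at \<open>x = 0\<close> is
  \<open>a 0\<close>.\<close>

lemma q_series_constant_imp_coeff_0:
  fixes a :: "nat \<Rightarrow> complex"
  assumes "\<And>\<tau>. \<tau> \<in> upper_half_plane \<Longrightarrow> (\<lambda>n. a n * ee (of_nat n * \<tau>)) sums w"
  shows "a 0 = w"
proof -
  have "(\<lambda>n. a n * x ^ n) sums w" if "x \<noteq> 0" "norm x < 1" for x
  proof -
    \<comment> \<open>A logarithm of \<open>x\<close>, chosen so that \<open>ee \<tau> = x\<close>;
      the bound \<open>norm x < 1\<close> puts it in the upper half-plane.\<close>
    define \<tau> where "\<tau> = Ln x / (2 * of_real pi * \<i>)"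
    have ee: "ee \<tau> = x"
      using that by (simp add: ee_def \<tau>_def)
    have "Im \<tau> = - ln (norm x) / (2 * pi)"
      using that by (simp add: \<tau>_def Im_divide power2_eq_square)
    then have "\<tau> \<in> upper_half_plane"
      using that by (simp add: upper_half_plane_def divide_neg_pos)
    from assms[OF this] show ?thesis
      by (simp add: ee flip: ee_power)
  qed
  then have "((\<lambda>_. w) \<longlongrightarrow> a 0) (at (0 :: complex))"
    by (rule powser_limit_0_strong[of 1 a "\<lambda>_. w", OF zero_less_one])
  then show ?thesis
    by (simp add: tendsto_const_iff)
qed

section \<open>Invariance of the twisted genus\<close>

context elliptic_genus
begin

lemma chat_mult_h: "chat h D \<delta> * of_nat h = of_int (D * int h - 2 * \<delta>)"
  using h_pos by (simp add: chat_def field_simps)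

text \<open>Once signs and factors are collected into one exponential, the parts of the two
  exponents that depend on \<open>\<tau>\<close> agree, and the rest differs by an integer.\<close>

lemma twisted_shift:
  assumes \<tau>: "\<tau> \<in> upper_half_plane"
  shows "twisted h D \<delta> Z (r + int h * m) (s + int h * n) \<tau> 0 = twisted h D \<delta> Z r s \<tau> 0"
proof -
  let ?k = "of_real (chat h D \<delta>) :: complex"
  let ?w = "of_int r * \<tau> + of_int s"
  let ?r = "r + int h * m" and ?s = "s + int h * n"
  \<comment> \<open>The exponent of the sign in \<open>elliptic\<close>, an integer by
    \<open>chat_mult_h\<close>.\<close>
  define M where "M = (D * int h - 2 * \<delta>) * (m + n)"
  have "chat h D \<delta> * of_int (int h * m + int h * n) = chat h D \<delta> * of_nat h * of_int (m + n)"
    by (simp add: algebra_simps)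
  also have "\<dots> = of_int M"
    unfolding chat_mult_h M_def by simp
  finally have "\<lfloor>chat h D \<delta> * of_int (int h * m + int h * n)\<rfloor> = M"
    by (simp only: floor_of_int)
  then have Z: "Z \<tau> (?w + of_int (int h * m) * \<tau> + of_int (int h * n)) =
    ee (of_int M / 2) * ee (- ?k / 2 * ((of_int (int h * m))\<^sup>2 * \<tau> + 2 * of_int (int h * m) * ?w)) * Z \<tau> ?w"
    using elliptic[of "int h * m" "int h * n" \<tau> ?w] \<tau> by (simp only: ee_half dvd_triv_left)
  have w: "0 + of_int ?r * \<tau> + of_int ?s = ?w + of_int (int h * m) * \<tau> + of_int (int h * n)"
    by (simp add: algebra_simps)
  have kh: "?k * of_nat h = of_int (D * int h - 2 * \<delta>)"
    using arg_cong[OF chat_mult_h, of of_real] by simp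
  have "twisted h D \<delta> Z ?r ?s \<tau> 0 =
    ee (of_int (D * (?r + ?s + ?r * ?s)) / 2
      + ?k / 2 * ((of_int ?r)\<^sup>2 * \<tau> + 2 * of_int ?r * 0 + of_int ?r * of_int ?s)
      + of_int M / 2 + (- ?k / 2 * ((of_int (int h * m))\<^sup>2 * \<tau> + 2 * of_int (int h * m) * ?w))) * Z \<tau> ?w"
    unfolding twisted_def w Z ee_add ee_half[symmetric] by (simp only: mult.assoc)
  also have "\<dots> = ee (of_int (D * (r + s + r * s)) / 2
      + ?k / 2 * ((of_int r)\<^sup>2 * \<tau> + 2 * of_int r * 0 + of_int r * of_int s)) * Z \<tau> ?w"
  proof (intro arg_cong2[where f = "(*)"] ee_eqI refl)
    \<comment> \<open>In the difference of the exponents the halves of multiples of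
      \<open>D * h\<close> occur in equal pairs, except for those with \<open>m * s\<close>, which
      cancel; this leaves the integer \<open>?K\<close>.\<close>
    let ?K = "D * int h * (m + n + r * n + int h * m * n)
      - \<delta> * (m + n + r * n - m * s + int h * m * n)"
    have "of_int (D * (?r + ?s + ?r * ?s)) / 2
      + ?k / 2 * ((of_int ?r)\<^sup>2 * \<tau> + 2 * of_int ?r * 0 + of_int ?r * of_int ?s)
      + of_int M / 2 + (- ?k / 2 * ((of_int (int h * m))\<^sup>2 * \<tau> + 2 * of_int (int h * m) * ?w))
      - (of_int (D * (r + s + r * s)) / 2
      + ?k / 2 * ((of_int r)\<^sup>2 * \<tau> + 2 * of_int r * 0 + of_int r * of_int s)) =
        of_int (D * (int h * (m + n + r * n + m * s + int h * m * n))) / 2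
      + (?k * of_nat h) * of_int (r * n - m * s + int h * m * n) / 2 + of_int M / 2"
      by (simp add: algebra_simps power2_eq_square add_divide_distrib diff_divide_distrib)
    also have "\<dots> = of_int ?K"
      unfolding kh M_def by (simp add: algebra_simps add_divide_distrib diff_divide_distrib)
    finally have "of_int (D * (?r + ?s + ?r * ?s)) / 2
      + ?k / 2 * ((of_int ?r)\<^sup>2 * \<tau> + 2 * of_int ?r * 0 + of_int ?r * of_int ?s)
      + of_int M / 2 + (- ?k / 2 * ((of_int (int h * m))\<^sup>2 * \<tau> + 2 * of_int (int h * m) * ?w))
      - (of_int (D * (r + s + r * s)) / 2
      + ?k / 2 * ((of_int r)\<^sup>2 * \<tau> + 2 * of_int r * 0 + of_int r * of_int s)) = of_int ?K" .
    then show "of_int (D * (?r + ?s + ?r * ?s)) / 2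
      + ?k / 2 * ((of_int ?r)\<^sup>2 * \<tau> + 2 * of_int ?r * 0 + of_int ?r * of_int ?s)
      + of_int M / 2 + (- ?k / 2 * ((of_int (int h * m))\<^sup>2 * \<tau> + 2 * of_int (int h * m) * ?w))
      - (of_int (D * (r + s + r * s)) / 2
      + ?k / 2 * ((of_int r)\<^sup>2 * \<tau> + 2 * of_int r * 0 + of_int r * of_int s)) \<in> \<int>"
      by (simp only: Ints_of_int)
  qed
  also have "\<dots> = twisted h D \<delta> Z r s \<tau> 0"
    by (simp add: twisted_def ee_add ee_half[symmetric])
  finally show ?thesis .
qed

text \<open>The law \<open>modular\<close> sends the point of \<open>(r, s)\<close> to the point of
  the row vector \<open>(r, s)\<close> times the matrix, and its automorphy factor is exactly the
  change in the quadratic exponent.\<close>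

lemma twisted_SL2:
  assumes det: "a * d - b * c = 1" and \<tau>: "\<tau> \<in> upper_half_plane"
  shows "twisted h D \<delta> Z r s ((of_int a * \<tau> + of_int b) / (of_int c * \<tau> + of_int d)) 0 =
         twisted h D \<delta> Z (r * a + s * c) (r * b + s * d) \<tau> 0"
proof -
  let ?k = "of_real (chat h D \<delta>) / 2 :: complex"
  let ?j = "of_int c * \<tau> + of_int d" and ?\<sigma> = "(of_int a * \<tau> + of_int b) / (of_int c * \<tau> + of_int d)"
  let ?r = "r * a + s * c" and ?s = "r * b + s * d"
  let ?w = "of_int ?r * \<tau> + of_int ?s"
  have j: "?j \<noteq> 0"
    by (rule moebius_upper_half_plane(1)[OF det \<tau>])
  have w: "0 + of_int r * ?\<sigma> + of_int s = ?w / ?j"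
    using j by (simp add: field_simps)
  \<comment> \<open>The number \<open>r + s + r * s\<close> is even exactly when \<open>r\<close>
    and \<open>s\<close> both are, a condition preserved by a matrix invertible modulo 2.\<close>
  have "even (r + s + r * s) \<longleftrightarrow> even (?r + ?s + ?r * ?s)"
  proof -
    have "odd (a * d - b * c)" using det by simp
    then show ?thesis by auto
  qed
  then have "even (D * (r + s + r * s)) \<longleftrightarrow> even (D * (?r + ?s + ?r * ?s))"
    by (simp only: even_mult_iff)
  then have sgn: "(-1 :: complex) powi (D * (r + s + r * s)) = (-1) powi (D * (?r + ?s + ?r * ?s))"
    by (simp only: power_int_minus_left power_int_1_left)
  have det': "of_int a * of_int d = 1 + of_int b * (of_int c :: complex)"
  proof -
    have "a * d = 1 + b * c" using det by simp
    from arg_cong[OF this, of of_int] show ?thesis by simp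
  qed
  have expo: "(of_int r)\<^sup>2 * ?\<sigma> + of_int r * of_int s + of_int c * ?w\<^sup>2 / ?j =
    (of_int ?r)\<^sup>2 * \<tau> + of_int ?r * of_int ?s"
  proof -
    have "(of_int r)\<^sup>2 * ?\<sigma> + of_int r * of_int s = of_int r * (0 + of_int r * ?\<sigma> + of_int s)"
      by (simp only: power2_eq_square distrib_left mult.assoc mult_zero_right add_0)
    moreover have "of_int r * (x / ?j) + of_int c * x\<^sup>2 / ?j = x * (of_int r + of_int c * x) / ?j" for x
      by (simp only: power2_eq_square distrib_left add_divide_distrib times_divide_eq_right ac_simps)
    ultimately have "(of_int r)\<^sup>2 * ?\<sigma> + of_int r * of_int s + of_int c * ?w\<^sup>2 / ?j =
      ?w * (of_int r + of_int c * ?w) / ?j"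
      by (simp only: w)
    \<comment> \<open>The determinant enters here through \<open>a * d = 1 + b * c\<close>, and the
      factor \<open>?j\<close> that appears cancels the denominator.\<close>
    also have "of_int r + of_int c * ?w = of_int ?r * ?j"
    proof -
      have "of_int ?r * ?j = of_int r * (of_int a * of_int d) + of_int c * of_int s * of_int d
        + of_int ?r * of_int c * \<tau>"
        by (simp add: algebra_simps)
      then show ?thesis
        unfolding det' by (simp add: algebra_simps)
    qed
    also have "?w * (of_int ?r * ?j) / ?j = ?w * of_int ?r"
      using j by (subst mult.assoc[symmetric]) (rule nonzero_mult_div_cancel_right)
    also have "\<dots> = (of_int ?r)\<^sup>2 * \<tau> + of_int ?r * of_int ?s"
      by (simp only: power2_eq_square distrib_left distrib_right mult_ac)
    finally show ?thesis .
  qed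
  have "twisted h D \<delta> Z r s ?\<sigma> 0 = (-1) powi (D * (?r + ?s + ?r * ?s)) *
    ee (?k * ((of_int r)\<^sup>2 * ?\<sigma> + of_int r * of_int s) + ?k * (of_int c * ?w\<^sup>2 / ?j)) * Z \<tau> ?w"
    unfolding twisted_def w modular[OF det \<tau>, of ?w] sgn by (simp add: ee_add)
  also have "\<dots> = twisted h D \<delta> Z ?r ?s \<tau> 0"
    unfolding distrib_left[symmetric] expo by (simp add: twisted_def)
  finally show ?thesis .
qed

end

section \<open>Computation of the twisted Witten indices\<close>

locale constant_elliptic_genus = elliptic_genus +
  assumes twisted_constant: "\<And>r s. (\<lambda>\<tau>. twisted h D \<delta> Z r s \<tau> 0) constant_on upper_half_plane"
begin

abbreviation index :: "int \<Rightarrow> int \<Rightarrow> complex" where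
  "index \<equiv> twisted_Witten_index h D \<delta> Z"

lemma i_in_upper_half_plane: "\<i> \<in> upper_half_plane"
  by (simp add: upper_half_plane_def)

text \<open>Constancy provides a common value and the point \<open>\<i>\<close> makes it unique, so
  the definite description denotes it.\<close>

lemma twisted_eq_index:
  assumes "\<tau> \<in> upper_half_plane"
  shows "twisted h D \<delta> Z r s \<tau> 0 = index r s"
proof -
  obtain w where w: "\<forall>\<tau>\<in>upper_half_plane. twisted h D \<delta> Z r s \<tau> 0 = w"
    using twisted_constant[of r s] by (auto simp: constant_on_def)
  then have "index r s = w"
    unfolding twisted_Witten_index_def using i_in_upper_half_plane by (intro the_equality) auto
  with w assms show ?thesis by simp
qed

lemma index_shift: "index (r + int h * m) (s + int h * n) = index r s"
  using twisted_shift[OF i_in_upper_half_plane, of r m s n]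
  by (simp only: twisted_eq_index[OF i_in_upper_half_plane])

lemma index_SL2:
  assumes "a * d - b * c = 1"
  shows "index (r * a + s * c) (r * b + s * d) = index r s"
  using twisted_SL2[OF assms i_in_upper_half_plane, of r s]
  by (simp only: twisted_eq_index i_in_upper_half_plane
      moebius_upper_half_plane(2)[OF assms i_in_upper_half_plane])

lemma index_eq_index_0_gcd: "index r s = index 0 (gcd r s)"
proof (cases "gcd r s = 0")
  case False
  define g where "g = gcd r s"
  obtain r' s' where rs: "r = g * r'" "s = g * s'"
    unfolding g_def by (meson dvdE gcd_dvd1 gcd_dvd2)
  obtain p q where pq: "p * r + q * s = g"
    using bezout_int[of r s] by (auto simp: g_def)
  then have "g * (p * r' + q * s') = g * 1"
    by (simp add: rs algebra_simps)
  with False have "p * r' + q * s' = 1"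
    unfolding mult_left_cancel[OF False[folded g_def]] by simp
  \<comment> \<open>The matrix with rows \<open>(s', p)\<close> and \<open>(- r', q)\<close>, built
    from Bezout coefficients, sends \<open>(r, s)\<close> to \<open>(0, g)\<close>.\<close>
  then have "s' * q - p * (- r') = 1"
    by (simp add: algebra_simps)
  then have "index (r * s' + s * (- r')) (r * p + s * q) = index r s"
    by (rule index_SL2)
  moreover have "r * s' + s * (- r') = 0" "r * p + s * q = g"
    using pq by (simp_all add: rs algebra_simps)
  ultimately show ?thesis by (simp add: g_def)
qed simp

lemma index_eq_index_0_gcd_h: "index r s = index 0 (gcd (int h) (gcd r s))"
proof -
  \<comment> \<open>Shifting \<open>(0, gcd r s)\<close> to \<open>(h, gcd r s)\<close> keeps the
    index, and a second reduction brings \<open>h\<close> into the gcd.\<close>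
  have "index r s = index (0 + int h * 1) (gcd r s + int h * 0)"
    by (simp only: index_shift) (rule index_eq_index_0_gcd)
  also have "\<dots> = index 0 (gcd (int h) (gcd r s))"
    by (subst index_eq_index_0_gcd) simp
  finally show ?thesis .
qed

text \<open>For \<open>r = 0\<close> the twist adds no power of \<open>q\<close>, so the constancy
  of the series in \<open>q\<close> leaves only its term at \<open>n = 0\<close>.\<close>

lemma index_0_eq_ZZ_0: "index 0 s = (-1) powi (D * s) * ZZ 0 (of_int s)"
proof -
  have "(\<lambda>n. ((-1) powi (D * s) * ZZ n (of_int s)) * ee (of_nat n * \<tau>)) sums index 0 s"
    if "\<tau> \<in> upper_half_plane" for \<tau>
    using sums_mult[OF q_expansion[OF that], of "(-1) powi (D * s)" "of_int s"]
      twisted_eq_index[OF that, of 0 s]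
    by (simp add: twisted_def mult.assoc ee_def)
  from q_series_constant_imp_coeff_0[OF this] show ?thesis by simp
qed

lemma index_0_eq_sum_roots:
  "index 0 (int s) = (\<Sum>j<h. of_int (residue_coeff h \<delta> chi j) * ee (of_nat j * of_nat s / of_nat h))"
proof -
  let ?x = "ee (of_nat s / of_nat h)"
  have "index 0 (int s) = ee (of_int (D * int s) / 2 + - of_real (chat h D \<delta>) / 2 * of_nat s) *
      poly (map_poly of_int chi) ?x"
    using index_0_eq_ZZ_0[of "int s"] ZZ_0[of "of_nat s"] by (simp only: ee_add ee_half poly_y_def) simp
  \<comment> \<open>The sign contributes \<open>D * s / 2\<close>, which cancels the part of
    \<open>chat\<close> coming from \<open>D\<close>. What remains is \<open>y^(\<delta>/h)\<close>
    at \<open>z = s\<close>, the factor that shifts the exponents of \<open>chi\<close>.\<close>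
  also have "of_int (D * int s) / 2 + - of_real (chat h D \<delta>) / 2 * of_nat s =
      of_int \<delta> * (of_nat s / of_nat h :: complex)"
    using h_pos by (simp add: chat_def field_simps)
  also have "ee \<dots> = ?x powi \<delta>"
    by (simp add: ee_powi)
  also have "\<dots> * poly (map_poly of_int chi) ?x =
      (\<Sum>i | chi_shift_coeff \<delta> chi i \<noteq> 0. of_int (chi_shift_coeff \<delta> chi i) * ee (of_int i * of_int (int s) / of_nat h))"
    unfolding poly_eq_sum_chi_shift[OF ee_nonzero] unfolding ee_powi by simp
  also have "\<dots> = (\<Sum>j<h. of_int (residue_coeff h \<delta> chi j) * ee (of_int (int j) * of_int (int s) / of_nat h))"
    by (intro sum_chi_shift_by_residue h_pos ee_mod_div)
  finally show ?thesis by simp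
qed

text \<open>The Fourier transform of these coefficients is the index at \<open>(0, s)\<close>, which
  depends on \<open>gcd s h\<close> only.\<close>

lemma residue_coeff_gcd: "residue_coeff h \<delta> chi j = residue_coeff h \<delta> chi (gcd j h)"
proof (rule fourier_coeff_depends_on_gcd[OF h_pos])
  show "index 0 (int s) = index 0 (int (gcd s h))" for s
    using index_eq_index_0_gcd_h[of 0 "int s"] by (simp add: gcd.commute)
qed (rule index_0_eq_sum_roots residue_coeff_mod)+

section \<open>The expansion of \<open>Upsilon\<close> and its uniqueness\<close>

lemma Upsilon_eq_iff:
  "Upsilon h \<delta> chi = (\<Sum>d | d dvd h. of_int (u d) * Lam d) \<longleftrightarrow>
   (\<forall>j<h. residue_coeff h \<delta> chi j = (\<Sum>d | d dvd h. if h div d dvd j then u d else 0))"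
  unfolding Upsilon_eq_sum_bas[OF h_pos] sum_Lam_eq_sum_bas[OF h_pos] sum_bas_roots_of_unity_eq_iff ..

text \<open>Since \<open>residue_coeff\<close> is a function of the gcd with \<open>h\<close>, its
  divisor inversion solves the linear system of \<open>Upsilon_eq_iff\<close> in integers.\<close>

lemma ex_Upsilon_expansion: "\<exists>u. Upsilon h \<delta> chi = (\<Sum>d | d dvd h. of_int (u d) * Lam d)"
proof -
  let ?N = "residue_coeff h \<delta> chi"
  define w where "w = divisor_inversion ?N"
  have "?N j = (\<Sum>d | d dvd h. if h div d dvd j then w (h div d) else 0)" for j
  proof -
    have "?N j = (\<Sum>e | e dvd gcd j h. w e)"
      unfolding w_def using h_pos by (subst residue_coeff_gcd, subst sum_divisor_inversion) simp_all
    also have "\<dots> = (\<Sum>e | e dvd h. if e dvd j then w e else 0)"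
      using h_pos by (simp only: sum_if_divides_eq_sum_dvd_gcd)
    finally show ?thesis
      using sum_complementary_divisor[OF h_pos, of "\<lambda>e. if e dvd j then w e else 0"] by simp
  qed
  \<comment> \<open>\<open>Lam d\<close> is supported on the multiples of \<open>h div d\<close>,
    hence the complementary divisor in the witness.\<close>
  then show ?thesis
    by (intro exI[of _ "\<lambda>d. w (h div d)"]) (simp add: Upsilon_eq_iff)
qed

context
  fixes u :: "nat \<Rightarrow> int"
  assumes Upsilon: "Upsilon h \<delta> chi = (\<Sum>d | d dvd h. of_int (u d) * Lam d)"
begin

text \<open>In the Fourier sum each \<open>Lam d\<close> contributes the sum of the
  \<open>s\<close>-th powers of the \<open>d\<close>-th roots of unity, which is \<open>d\<close> if
  \<open>d dvd s\<close> and 0 otherwise.\<close>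

lemma index_0_eq_sum_divisors:
  "index 0 (int s) = of_int (\<Sum>d | d dvd gcd s h. u d * int d)"
proof -
  have "index 0 (int s) =
    (\<Sum>j<h. \<Sum>d | d dvd h. of_int (u d) * (if h div d dvd j then ee (of_int (int s) * of_nat j / of_nat h) else 0))"
    unfolding index_0_eq_sum_roots
  proof (rule sum.cong)
    fix j assume "j \<in> {..<h}"
    then have eq: "residue_coeff h \<delta> chi j = (\<Sum>d | d dvd h. if h div d dvd j then u d else 0)"
      using Upsilon unfolding Upsilon_eq_iff by simp
    show "of_int (residue_coeff h \<delta> chi j) * ee (of_nat j * of_nat s / of_nat h) =
      (\<Sum>d | d dvd h. of_int (u d) * (if h div d dvd j then ee (of_int (int s) * of_nat j / of_nat h) else 0))"
      unfolding eq of_int_sum sum_distrib_right by (intro sum.cong refl) (simp add: mult.commute)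
  qed simp
  also have "\<dots> = (\<Sum>d | d dvd h. of_int (u d) *
      (\<Sum>j<h. if h div d dvd j then ee (of_int (int s) * of_nat j / of_nat h) else 0))"
    by (subst sum.swap) (simp only: sum_distrib_left)
  also have "\<dots> = (\<Sum>d | d dvd h. if d dvd s then of_int (u d * int d) else 0)"
  proof (rule sum.cong)
    fix d assume "d \<in> {d. d dvd h}"
    then have d: "h div d dvd h" "h div (h div d) = d"
      using h_pos by (auto elim!: dvdE)
    show "of_int (u d) * (\<Sum>j<h. if h div d dvd j then ee (of_int (int s) * of_nat j / of_nat h) else 0) =
      (if d dvd s then of_int (u d * int d) else 0)"
      unfolding sum_roots_of_unity_multiples[OF d(1) h_pos] d(2) by simp
  qed simp
  finally show ?thesis
    using h_pos by (simp only: sum_if_divides_eq_sum_dvd_gcd of_int_sum)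
qed

lemma index_eq_sum_divisors_gcd:
  "index r s = of_int (\<Sum>d | int d dvd gcd (int h) (gcd r s). u d * int d)"
proof -
  define g where "g = nat (gcd (int h) (gcd r s))"
  have g: "int g = gcd (int h) (gcd r s)"
    by (simp add: g_def)
  then have "g dvd h"
    by (metis gcd_dvd1 int_dvd_int_iff)
  then have "gcd g h = g"
    by (simp add: gcd_nat.absorb1)
  have "index r s = index 0 (int g)"
    unfolding g by (rule index_eq_index_0_gcd_h)
  then show ?thesis
    unfolding index_0_eq_sum_divisors \<open>gcd g h = g\<close> g[symmetric] by simp
qed

lemma index_eq_sum_Delt: "index r s = of_int (\<Sum>d | d dvd h. u d * Delt d r s)"
  unfolding index_eq_sum_divisors_gcd of_int_eq_iff
  using h_pos by (intro sum.mono_neutral_cong_left) (auto simp: Delt_def)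

end

text \<open>Both expansions compute the same indices at \<open>(0, n)\<close> for
  \<open>n dvd h\<close>. These divisor sums determine \<open>u d * int d\<close>, and the positive
  factor \<open>d\<close> cancels.\<close>

lemma Upsilon_expansion_unique:
  assumes u: "Upsilon h \<delta> chi = (\<Sum>d | d dvd h. of_int (u d) * Lam d)"
    and u': "Upsilon h \<delta> chi = (\<Sum>d | d dvd h. of_int (u' d) * Lam d)"
    and "d dvd h"
  shows "u d = u' d"
proof -
  have "(\<Sum>d | d dvd n. u d * int d) = (\<Sum>d | d dvd n. u' d * int d)" if "n dvd h" for n
  proof -
    have "of_int (\<Sum>d | d dvd gcd n h. u d * int d) = (of_int (\<Sum>d | d dvd gcd n h. u' d * int d) :: complex)"
      using index_0_eq_sum_divisors[OF u, of n] index_0_eq_sum_divisors[OF u', of n] by metis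
    then show ?thesis
      using that by (simp only: of_int_eq_iff gcd_nat.absorb1)
  qed
  then have "u d * int d = u' d * int d"
    by (rule divisor_sums_eq_imp_eq) (use h_pos assms(3) in auto)
  then show ?thesis
    using h_pos assms(3) by auto
qed

end

theorem mainTheorem3:
  fixes h :: nat and D \<delta> :: int
    and Z :: "complex \<Rightarrow> complex \<Rightarrow> complex"
    and ZZ :: "nat \<Rightarrow> complex \<Rightarrow> complex"
    and chi :: "int poly"
  assumes "elliptic_genus h D \<delta> Z ZZ chi"
    and "\<And>r s. (\<lambda>\<tau>. twisted h D \<delta> Z r s \<tau> 0) constant_on upper_half_plane"
  shows "(\<exists>!u :: nat \<Rightarrow> int. u \<in> {d. d dvd h} \<rightarrow>\<^sub>E UNIV \<and>
            Upsilon h \<delta> chi = (\<Sum>d | d dvd h. of_int (u d) * Lam d)) \<and>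
         (\<forall>u :: nat \<Rightarrow> int. Upsilon h \<delta> chi = (\<Sum>d | d dvd h. of_int (u d) * Lam d) \<longrightarrow>
            (\<forall>r s. twisted_Witten_index h D \<delta> Z r s =
                     of_int (\<Sum>d | d dvd h. u d * Delt d r s)) \<and>
            (\<forall>r s. twisted_Witten_index h D \<delta> Z r s =
                     of_int (\<Sum>d | int d dvd gcd (int h) (gcd r s). u d * int d)))"
proof -
  interpret constant_elliptic_genus h D \<delta> Z ZZ chi
    using assms by (intro constant_elliptic_genus.intro constant_elliptic_genus_axioms.intro)
  obtain u where u: "Upsilon h \<delta> chi = (\<Sum>d | d dvd h. of_int (u d) * Lam d)"
    using ex_Upsilon_expansion by blast
  have "\<exists>!u. u \<in> {d. d dvd h} \<rightarrow>\<^sub>E UNIV \<and>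
      Upsilon h \<delta> chi = (\<Sum>d | d dvd h. of_int (u d) * Lam d)"
  proof (rule ex1I)
    \<comment> \<open>The expansion constrains \<open>u\<close> at the divisors of \<open>h\<close>
      only; the extensional function space fixes the other values to \<open>undefined\<close>, so
      the witness is a restriction.\<close>
    show "restrict u {d. d dvd h} \<in> {d. d dvd h} \<rightarrow>\<^sub>E UNIV \<and>
      Upsilon h \<delta> chi = (\<Sum>d | d dvd h. of_int (restrict u {d. d dvd h} d) * Lam d)"
      by (simp add: u)
  next
    fix u'
    assume u': "u' \<in> {d. d dvd h} \<rightarrow>\<^sub>E UNIV \<and>
      Upsilon h \<delta> chi = (\<Sum>d | d dvd h. of_int (u' d) * Lam d)"
    then show "u' = restrict u {d. d dvd h}"
      using Upsilon_expansion_unique[OF _ u, of u'] by (auto simp: PiE_def extensional_def)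
  qed
  then show ?thesis
    using index_eq_sum_Delt index_eq_sum_divisors_gcd by blast
qed

end
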